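(* Suppose that $X$ is a metric space, and $X = Y \cup Z$. Then $\dim_{\rm N} X = \sup\{\dim_{\rm N} Y, \dim_{\rm N} Z\}$.
   Context: A family $(B_i)_{i\in I}$ of subsets of a metric space $X=(X,d)$ is called $D$-bounded ($D \ge 0$) if $\operatorname{diam} B_i := \sup\{d(x,x') : x,x'\in B_i\} \le D$ for all $i$. For $s>0$, the $s$-multiplicity of the family is the infimum of all integers $n \ge 0$ such that every subset of $X$ with diameter $\le s$ meets at most $n$ members of the family. The Nagata dimension $\dim_{\rm N} X$ of a metric space $X$ is the infimum of all integers $n$ with the following property: there exists a constant $c>0$ such that for all $s>0$, $X$ has a $cs$-bounded covering with $s$-multiplicity at most $n+1$ (the value is $\infty$ if there is no such $n$). Subsets of a metric space carry the induced metric. *)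

theory Defs
  imports "HOL-Analysis.Analysis"
begin

text \<open>
  A metric space is a carrier set together with a distance function (\<open>Metric_space\<close> in the library),
  and a subset carries the same distance function. Diameters are extended-real valued, since the
  library's real-valued \<open>diameter\<close> has no meaningful value on unbounded sets. The empty set has
  diameter \<open>-\<infinity>\<close>; diameters are only ever compared with nonnegative bounds, so this is
  indistinguishable from the convention that it is \<open>0\<close>.
\<close>

definition ediam :: "('a \<Rightarrow> 'a \<Rightarrow> real) \<Rightarrow> 'a set \<Rightarrow> ereal"
  where "ediam d A = Sup {ereal (d x y) | x y. x \<in> A \<and> y \<in> A}"

definition family_bounded :: "('a \<Rightarrow> 'a \<Rightarrow> real) \<Rightarrow> real \<Rightarrow> 'i set \<Rightarrow> ('i \<Rightarrow> 'a set) \<Rightarrow> bool"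
  where "family_bounded d D I B \<longleftrightarrow> 0 \<le> D \<and> (\<forall>i\<in>I. ediam d (B i) \<le> ereal D)"

text \<open>Members of a family are counted by index, and \<open>Inf {} = \<infinity>\<close>.\<close>

definition multiplicity_at ::
    "'a set \<Rightarrow> ('a \<Rightarrow> 'a \<Rightarrow> real) \<Rightarrow> real \<Rightarrow> 'i set \<Rightarrow> ('i \<Rightarrow> 'a set) \<Rightarrow> enat"
  where "multiplicity_at X d s I B =
    Inf {enat n | n. \<forall>A\<subseteq>X. ediam d A \<le> ereal s \<longrightarrow>
           finite {i \<in> I. A \<inter> B i \<noteq> {}} \<and> card {i \<in> I. A \<inter> B i \<noteq> {}} \<le> n}"

definition is_covering :: "'a set \<Rightarrow> 'i set \<Rightarrow> ('i \<Rightarrow> 'a set) \<Rightarrow> bool"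
  where "is_covering X I B \<longleftrightarrow> (\<forall>i\<in>I. B i \<subseteq> X) \<and> X \<subseteq> (\<Union>i\<in>I. B i)"

text \<open>
  The infimum ranges over all integers, as in the definition being formalized, so that the empty
  space has dimension \<open>-1\<close> (it is covered by the empty family, of multiplicity \<open>0\<close>). If no \<open>n\<close>
  qualifies the value is \<open>Inf {} = \<infinity>\<close>. Coverings are indexed by subsets of the type of sets of
  points. This is no restriction: \<open>covering_index_change\<close> below replaces a covering with an
  arbitrary index type by the set of its members.
\<close>

definition nagata_dim_le :: "'a set \<Rightarrow> ('a \<Rightarrow> 'a \<Rightarrow> real) \<Rightarrow> int \<Rightarrow> bool"
  where "nagata_dim_le X d n \<longleftrightarrow>
    (\<exists>c>0. \<forall>s>0. \<exists>(I :: 'a set set) (B :: 'a set \<Rightarrow> 'a set).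
       is_covering X I B \<and> family_bounded d (c * s) I B \<and>
       ereal_of_enat (multiplicity_at X d s I B) \<le> ereal (real_of_int (n + 1)))"

definition nagata_dim :: "'a set \<Rightarrow> ('a \<Rightarrow> 'a \<Rightarrow> real) \<Rightarrow> ereal"
  where "nagata_dim X d = Inf {ereal (real_of_int n) | n. nagata_dim_le X d n}"

lemma covering_index_change:
  fixes I :: "'i set" and B :: "'i \<Rightarrow> 'a set"
  assumes "is_covering X I B" and "family_bounded d D I B"
  shows "is_covering X (B ` I) (\<lambda>C. C)" and "family_bounded d D (B ` I) (\<lambda>C. C)"
    and "multiplicity_at X d s (B ` I) (\<lambda>C. C) \<le> multiplicity_at X d s I B"
proof -
  show "is_covering X (B ` I) (\<lambda>C. C)" "family_bounded d D (B ` I) (\<lambda>C. C)"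
    using assms by (auto simp: is_covering_def family_bounded_def)
  have img: "{C \<in> B ` I. A \<inter> C \<noteq> {}} = B ` {i \<in> I. A \<inter> B i \<noteq> {}}" for A
    by auto
  show "multiplicity_at X d s (B ` I) (\<lambda>C. C) \<le> multiplicity_at X d s I B"
    unfolding multiplicity_at_def img
  proof (rule Inf_superset_mono, rule subsetI)
    fix m
    assume "m \<in> {enat n | n. \<forall>A\<subseteq>X. ediam d A \<le> ereal s \<longrightarrow>
        finite {i \<in> I. A \<inter> B i \<noteq> {}} \<and> card {i \<in> I. A \<inter> B i \<noteq> {}} \<le> n}"
    then obtain n where "m = enat n" and n: "\<And>A. A \<subseteq> X \<Longrightarrow> ediam d A \<le> ereal s \<Longrightarrow>
        finite {i \<in> I. A \<inter> B i \<noteq> {}} \<and> card {i \<in> I. A \<inter> B i \<noteq> {}} \<le> n"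
      by auto
    have "finite (B ` {i \<in> I. A \<inter> B i \<noteq> {}}) \<and> card (B ` {i \<in> I. A \<inter> B i \<noteq> {}}) \<le> n"
      if "A \<subseteq> X" "ediam d A \<le> ereal s" for A
      using n[OF that] by (auto intro: order_trans[OF card_image_le])
    with \<open>m = enat n\<close> show "m \<in> {enat n | n. \<forall>A\<subseteq>X. ediam d A \<le> ereal s \<longrightarrow>
        finite (B ` {i \<in> I. A \<inter> B i \<noteq> {}}) \<and> card (B ` {i \<in> I. A \<inter> B i \<noteq> {}}) \<le> n}"
      by blast
  qed
qed

lemma nagata_dim_empty: "nagata_dim {} d = -1"
proof -
  have mult: "multiplicity_at {} d s {} B = 0" for s and B :: "'a set \<Rightarrow> 'a set"
  proof -
    have "multiplicity_at {} d s {} B \<le> enat 0"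
      unfolding multiplicity_at_def by (rule Inf_lower) simp
    then show ?thesis by (simp add: zero_enat_def[symmetric])
  qed
  have "nagata_dim_le {} d (-1)"
    unfolding nagata_dim_le_def
  proof (rule exI[of _ 1], intro conjI allI impI)
    fix s :: real assume "s > 0"
    then have "is_covering {} {} id \<and> family_bounded d (1 * s) {} id \<and>
        ereal_of_enat (multiplicity_at {} d s {} id) \<le> ereal (real_of_int (- 1 + 1))"
      by (simp add: mult is_covering_def family_bounded_def)
    then show "\<exists>(I :: 'a set set) (B :: 'a set \<Rightarrow> 'a set).
        is_covering {} I B \<and> family_bounded d (1 * s) I B \<and>
        ereal_of_enat (multiplicity_at {} d s I B) \<le> ereal (real_of_int (- 1 + 1))"
      by blast
  qed simp
  moreover have "-1 \<le> n" if le: "nagata_dim_le {} d n" for n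
  proof -
    obtain c where c: "\<forall>s>0. \<exists>(I :: 'a set set) (B :: 'a set \<Rightarrow> 'a set).
       is_covering {} I B \<and> family_bounded d (c * s) I B \<and>
       ereal_of_enat (multiplicity_at {} d s I B) \<le> ereal (real_of_int (n + 1))"
      using le unfolding nagata_dim_le_def by blast
    obtain I :: "'a set set" and B :: "'a set \<Rightarrow> 'a set"
      where "ereal_of_enat (multiplicity_at {} d 1 I B) \<le> ereal (real_of_int (n + 1))"
      using c[rule_format, OF zero_less_one] by blast
    moreover have "0 \<le> ereal_of_enat (multiplicity_at {} d 1 I B)"
      by simp
    ultimately have "ereal 0 \<le> ereal (real_of_int (n + 1))"
      using order_trans zero_ereal_def by metis
    then show ?thesis by simp
  qed
  ultimately have "nagata_dim {} d = ereal (real_of_int (-1))"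
    unfolding nagata_dim_def
  proof (intro antisym Inf_lower Inf_greatest)
    fix x assume "x \<in> {ereal (real_of_int n) | n. nagata_dim_le {} d n}"
    then obtain n where "x = ereal (real_of_int n)" "nagata_dim_le {} d n"
      by blast
    with \<open>\<And>n. nagata_dim_le {} d n \<Longrightarrow> -1 \<le> n\<close> show "ereal (real_of_int (-1)) \<le> x"
      by (simp only: ereal_less_eq of_int_le_iff)
  qed blast
  then show ?thesis by (simp add: one_ereal_def)
qed

end

theory Submission imports Defs begin

text \<open>
  Inclusions \<open>Y \<subseteq> X\<close> do not raise the dimension, since coverings restrict. The other inequality says
  that coverings of \<open>Y\<close> and of \<open>Z\<close>, each of multiplicity at most \<open>m = n + 1\<close>, can be amalgamated
  into one covering of \<open>Y \<union> Z\<close> of multiplicity at most \<open>m\<close>, not merely \<open>2m\<close>. Low multiplicity alone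
  gives no hint which members to glue together, so the proof passes to \<^emph>\<open>coloured\<close> coverings: the
  members are distributed over \<open>m\<close> colours, and distinct members of one colour are more than \<open>r\<close>
  apart.

  A coloured covering obviously has \<open>r\<close>-multiplicity at most \<open>m\<close>. Conversely
  (\<open>coloured_covering_of_multiplicity\<close>), given a covering \<open>(B i)\<close> of low multiplicity on a scale much
  larger than \<open>r\<close>, measure the depth at which a point \<open>x\<close> sits in the \<open>\<rho>\<close>-neighbourhood of each
  \<open>B i\<close>. At most \<open>m\<close> depths are positive, so somewhere between \<open>0\<close> and \<open>\<rho>\<close> there is a gap of length
  \<open>2r\<close> without any depth. The set \<open>J\<close> of indices whose depth lies above the gap has at most \<open>m\<close>
  elements, and at least one because a member containing \<open>x\<close> has depth \<open>\<rho>\<close>. Its cardinality is the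
  colour given to \<open>x\<close> (several gaps may offer several colours, which does no harm). The points
  with the same \<open>J\<close> form one member. Two distinct sets \<open>J\<close> of the same cardinality are incomparable,
  so between their members two depths have to exchange order across a gap; since depths are
  1-Lipschitz this takes a distance of at least \<open>2r\<close>.

  Coloured coverings amalgamate one colour at a time (\<open>coloured_covering_Un\<close>). Separate the members
  on \<open>Y\<close> by much more than the diameter of the members on \<open>Z\<close>, and let every member on \<open>Y\<close> absorb
  the members on \<open>Z\<close> that come within distance \<open>r\<close> of it. The enlarged members remain apart, and
  everything that has not been absorbed is far from all of them. All constants are linear in \<open>r\<close>,
  as the Nagata dimension demands.
\<close>

section \<open>Diameter and multiplicity as bounds\<close>

lemma ediam_le_iff: "ediam d A \<le> ereal D \<longleftrightarrow> (\<forall>x\<in>A. \<forall>y\<in>A. d x y \<le> D)"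
  unfolding ediam_def Sup_le_iff by (force simp flip: ereal_less_eq(3))

lemma multiplicity_at_le_iff:
  "multiplicity_at X d s I B \<le> enat m \<longleftrightarrow>
    (\<forall>A\<subseteq>X. (\<forall>x\<in>A. \<forall>y\<in>A. d x y \<le> s) \<longrightarrow>
       finite {i \<in> I. A \<inter> B i \<noteq> {}} \<and> card {i \<in> I. A \<inter> B i \<noteq> {}} \<le> m)"
  (is "?l \<longleftrightarrow> ?r")
proof
  assume ?l
  then have "multiplicity_at X d s I B < enat (Suc m)"
    using le_less_trans by fastforce
  then obtain n where "n < Suc m" and "\<forall>A\<subseteq>X. ediam d A \<le> ereal s \<longrightarrow>
       finite {i \<in> I. A \<inter> B i \<noteq> {}} \<and> card {i \<in> I. A \<inter> B i \<noteq> {}} \<le> n"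
    unfolding multiplicity_at_def Inf_less_iff by auto
  then show ?r
    unfolding ediam_le_iff less_Suc_eq_le using order_trans by blast
next
  assume ?r
  then show ?l
    unfolding multiplicity_at_def ediam_le_iff by (intro Inf_lower) auto
qed

section \<open>Coloured coverings\<close>

definition coloured_covering ::
    "'a set \<Rightarrow> ('a \<Rightarrow> 'a \<Rightarrow> real) \<Rightarrow> nat \<Rightarrow> real \<Rightarrow> real \<Rightarrow> (nat \<Rightarrow> 'a set set) \<Rightarrow> bool"
  where "coloured_covering X d m r D F \<longleftrightarrow>
    (\<forall>k<m. \<forall>U\<in>F k. U \<subseteq> X \<and> (\<forall>x\<in>U. \<forall>y\<in>U. d x y \<le> D)) \<and>
    (\<forall>k<m. \<forall>U\<in>F k. \<forall>V\<in>F k. U \<noteq> V \<longrightarrow> (\<forall>x\<in>U. \<forall>y\<in>V. r < d x y)) \<and>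
    (\<forall>x\<in>X. \<exists>k<m. \<exists>U\<in>F k. x \<in> U)"

lemma coloured_coveringD:
  assumes "coloured_covering X d m r D F"
  shows "\<And>k U. k < m \<Longrightarrow> U \<in> F k \<Longrightarrow> U \<subseteq> X"
    and "\<And>k U x y. k < m \<Longrightarrow> U \<in> F k \<Longrightarrow> x \<in> U \<Longrightarrow> y \<in> U \<Longrightarrow> d x y \<le> D"
    and "\<And>k U V x y. k < m \<Longrightarrow> U \<in> F k \<Longrightarrow> V \<in> F k \<Longrightarrow> U \<noteq> V \<Longrightarrow> x \<in> U \<Longrightarrow> y \<in> V \<Longrightarrow> r < d x y"
    and "\<And>x. x \<in> X \<Longrightarrow> \<exists>k<m. \<exists>U\<in>F k. x \<in> U"
  using assms unfolding coloured_covering_def by simp_all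

lemma coloured_covering_subset:
  assumes F: "coloured_covering X d m r D F" and "Y \<subseteq> X"
  shows "coloured_covering Y d m r D (\<lambda>k. (\<lambda>U. U \<inter> Y) ` F k)"
  unfolding coloured_covering_def
proof (intro conjI allI impI ballI)
  fix k U V x y
  assume k: "k < m" and "U \<in> (\<lambda>U. U \<inter> Y) ` F k" "V \<in> (\<lambda>U. U \<inter> Y) ` F k" "U \<noteq> V" "x \<in> U" "y \<in> V"
  then obtain U' V' where "U' \<in> F k" "V' \<in> F k" "U' \<noteq> V'" "x \<in> U'" "y \<in> V'"
    by auto
  then show "r < d x y"
    by (rule coloured_coveringD(3)[OF F k])
next
  fix k U x y
  assume k: "k < m" and "U \<in> (\<lambda>U. U \<inter> Y) ` F k" "x \<in> U" "y \<in> U"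
  then obtain U' where "U' \<in> F k" "x \<in> U'" "y \<in> U'"
    by auto
  then show "d x y \<le> D"
    by (rule coloured_coveringD(2)[OF F k])
next
  fix x assume "x \<in> Y"
  then obtain k U where "k < m" "U \<in> F k" "x \<in> U"
    using coloured_coveringD(4)[OF F] \<open>Y \<subseteq> X\<close> by blast
  then show "\<exists>k<m. \<exists>U\<in>(\<lambda>U. U \<inter> Y) ` F k. x \<in> U"
    using \<open>x \<in> Y\<close> by blast
qed auto

lemma coloured_covering_more_colours:
  assumes F: "coloured_covering X d m r D F" and "m \<le> m'"
  shows "coloured_covering X d m' r D (\<lambda>k. if k < m then F k else {})"
  unfolding coloured_covering_def
proof (intro conjI allI impI ballI)
  fix x assume "x \<in> X"
  then obtain k U where "k < m" "U \<in> F k" "x \<in> U"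
    using coloured_coveringD(4)[OF F] by blast
  moreover have "k < m'"
    using \<open>k < m\<close> \<open>m \<le> m'\<close> by simp
  ultimately show "\<exists>k<m'. \<exists>U\<in>if k < m then F k else {}. x \<in> U"
    by (intro exI[of _ k] conjI bexI[of _ U]) simp_all
qed (use coloured_coveringD(1,2,3)[OF F] in \<open>simp_all split: if_splits add: subset_iff\<close>)

text \<open>A set of diameter at most \<open>r\<close> meets at most one member of each colour.\<close>

lemma multiplicity_coloured_covering:
  assumes F: "coloured_covering X d m r D F"
  shows "multiplicity_at X d r (\<Union>k<m. F k) (\<lambda>U. U) \<le> enat m"
  unfolding multiplicity_at_le_iff
proof (intro allI impI)
  fix A assume "A \<subseteq> X" and A: "\<forall>x\<in>A. \<forall>y\<in>A. d x y \<le> r"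
  define G where "G k = {U \<in> F k. A \<inter> U \<noteq> {}}" for k
  have one: "finite (G k) \<and> card (G k) \<le> 1" if "k < m" for k
  proof -
    have "U = V" if UV: "U \<in> G k" "V \<in> G k" for U V
    proof (rule ccontr)
      assume "U \<noteq> V"
      obtain x y where "x \<in> A" "x \<in> U" "y \<in> A" "y \<in> V"
        using UV unfolding G_def by auto
      then have "r < d x y" "d x y \<le> r"
        using coloured_coveringD(3)[OF F \<open>k < m\<close> _ _ \<open>U \<noteq> V\<close>] UV A unfolding G_def by auto
      then show False by simp
    qed
    then obtain U where "G k \<subseteq> {U}"
      by blast
    then show ?thesis
      using finite_subset[of "G k" "{U}"] card_mono[of "{U}" "G k"] by simp
  qed
  have eq: "{U \<in> \<Union>k<m. F k. A \<inter> U \<noteq> {}} = (\<Union>k<m. G k)"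
    unfolding G_def by auto
  have "card (\<Union>k<m. G k) \<le> (\<Sum>k<m. card (G k))"
    by (rule card_UN_le) simp
  also have "\<dots> \<le> (\<Sum>k<m. 1)"
    using one by (intro sum_mono) auto
  finally show "finite {U \<in> \<Union>k<m. F k. A \<inter> U \<noteq> {}} \<and>
      card {U \<in> \<Union>k<m. F k. A \<inter> U \<noteq> {}} \<le> m"
    unfolding eq using one by auto
qed

section \<open>Colouring a covering of low multiplicity\<close>

text \<open>
  This is \<open>max 0 (\<rho> - dist x B)\<close>, written as a supremum so that it makes sense for empty \<open>B\<close>.
\<close>

definition depth :: "('a \<Rightarrow> 'a \<Rightarrow> real) \<Rightarrow> real \<Rightarrow> 'a set \<Rightarrow> 'a \<Rightarrow> real"
  where "depth d \<rho> B x = Sup (insert 0 ((\<lambda>y. \<rho> - d x y) ` B))"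

context Metric_space
begin

lemma depth_bdd: "bdd_above (insert 0 ((\<lambda>y. \<rho> - d x y) ` B))"
  by (rule bdd_aboveI[of _ "max 0 \<rho>"]) (auto simp: le_max_iff_disj)

lemma depth_nonneg: "0 \<le> depth d \<rho> B x"
  unfolding depth_def by (rule cSup_upper[OF _ depth_bdd]) simp

lemma depth_ge: "y \<in> B \<Longrightarrow> \<rho> - d x y \<le> depth d \<rho> B x"
  unfolding depth_def by (rule cSup_upper[OF _ depth_bdd]) simp

lemma depth_posD:
  assumes "0 < depth d \<rho> B x"
  shows "\<exists>y\<in>B. d x y < \<rho>"
  using assms unfolding depth_def by (subst (asm) less_cSup_iff[OF _ depth_bdd]) auto

lemma depth_Lipschitz:
  assumes "x \<in> M" "y \<in> M" "B \<subseteq> M"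
  shows "depth d \<rho> B x \<le> depth d \<rho> B y + d x y"
  unfolding depth_def[of _ _ _ x]
proof (rule cSup_least)
  fix z assume "z \<in> insert 0 ((\<lambda>y. \<rho> - d x y) ` B)"
  then consider "z = 0" | b where "b \<in> B" "z = \<rho> - d x b"
    by auto
  then show "z \<le> depth d \<rho> B y + d x y"
  proof cases
    case 1
    then show ?thesis
      using depth_nonneg[of \<rho> B y] nonneg[of x y] by simp
  next
    case 2
    then have "d y b \<le> d x y + d x b"
      using triangle[of y x b] commute[of x y] assms by auto
    then show ?thesis
      using depth_ge[OF \<open>b \<in> B\<close>, of \<rho> y] 2 by linarith
  qed
qed simp

end

text \<open>
  Pigeonhole: at most \<open>m\<close> values cannot visit all of the \<open>m + 1\<close> disjoint intervals
  \<open>(j \<delta>, (j + 1) \<delta>]\<close> with \<open>j \<le> m\<close>.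
\<close>

lemma gap_exists:
  fixes f :: "'i \<Rightarrow> real"
  assumes "finite S" "card S \<le> m" "0 < \<delta>"
  shows "\<exists>j\<le>m. \<forall>i\<in>S. f i \<le> real j * \<delta> \<or> real (Suc j) * \<delta> < f i"
proof (rule ccontr)
  assume "\<not> ?thesis"
  then have "\<exists>i. i \<in> S \<and> real j * \<delta> < f i \<and> f i \<le> real (Suc j) * \<delta>" if "j \<le> m" for j
    using that by (meson not_le)
  then obtain g where g: "\<And>j. j \<le> m \<Longrightarrow> g j \<in> S \<and> real j * \<delta> < f (g j) \<and> f (g j) \<le> real (Suc j) * \<delta>"
    by metis
  have "inj_on g {..m}"
  proof (rule inj_onI)
    fix j j' assume jj: "j \<in> {..m}" "j' \<in> {..m}" "g j = g j'"
    then have "real j * \<delta> < real (Suc j') * \<delta>" "real j' * \<delta> < real (Suc j) * \<delta>"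
      using g[of j] g[of j'] by auto
    then show "j = j'"
      using \<open>0 < \<delta>\<close> by (simp only: mult_less_cancel_right_pos)
  qed
  then have "card {..m} \<le> card S"
    using g \<open>finite S\<close> by (intro card_inj_on_le) auto
  then show False
    using \<open>card S \<le> m\<close> by simp
qed

text \<open>
  The scale \<open>4 (m + 1) r\<close> is chosen so that the neighbourhoods of radius \<open>\<rho> = 2 (m + 1) r\<close>, half
  that scale, have room for \<open>m + 1\<close> candidate gaps of length \<open>2r\<close>.
\<close>

lemma (in Metric_space) coloured_covering_of_multiplicity:
  fixes B :: "'i \<Rightarrow> 'a set"
  assumes cover: "is_covering M I B" and bounded: "family_bounded d D I B"
    and mult: "multiplicity_at M d (4 * (real m + 1) * r) I B \<le> enat m" and "0 < r"
  shows "\<exists>F. coloured_covering M d m r (D + 4 * (real m + 1) * r) F"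
proof -
  define \<rho> where "\<rho> = 2 * (real m + 1) * r"
  define \<sigma> where "\<sigma> i = depth d \<rho> (B i)" for i
  define C where "C J = {x \<in> M. (\<forall>j\<in>J. 0 < \<sigma> j x) \<and> (\<forall>j\<in>J. \<forall>i\<in>I - J. \<sigma> i x + 2 * r \<le> \<sigma> j x)}" for J
  define F where "F k = C ` {J. J \<subseteq> I \<and> finite J \<and> card J = Suc k}" for k
  have scale: "4 * (real m + 1) * r = 2 * \<rho>"
    by (simp add: \<rho>_def)
  have BM: "B i \<subseteq> M" if "i \<in> I" for i
    using cover that by (auto simp: is_covering_def)
  have "coloured_covering M d m r (D + 4 * (real m + 1) * r) F"
    unfolding coloured_covering_def
  proof (intro conjI allI impI ballI)
    fix k U assume "k < m" "U \<in> F k"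
    then obtain J where J: "J \<subseteq> I" "finite J" "card J = Suc k" "U = C J"
      unfolding F_def by auto
    then show "U \<subseteq> M"
      unfolding C_def by auto
    obtain j where "j \<in> J"
      using J by fastforce
    then have "j \<in> I" using J by auto
    fix x y assume "x \<in> U" "y \<in> U"
    then have xy: "x \<in> M" "y \<in> M" "0 < \<sigma> j x" "0 < \<sigma> j y"
      using \<open>U = C J\<close> \<open>j \<in> J\<close> unfolding C_def by auto
    obtain a b where a: "a \<in> B j" "d x a < \<rho>" and b: "b \<in> B j" "d y b < \<rho>"
      using xy depth_posD unfolding \<sigma>_def by meson
    have M: "a \<in> M" "b \<in> M"
      using a b BM[OF \<open>j \<in> I\<close>] by auto
    have "d a b \<le> D"
      using bounded \<open>j \<in> I\<close> a b unfolding family_bounded_def ediam_le_iff by auto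
    moreover have "d x y \<le> d x a + d a b + d y b"
      using triangle[of x a y] triangle[of a b y] commute[of b y] xy(1,2) M by linarith
    ultimately show "d x y \<le> D + 4 * (real m + 1) * r"
      unfolding scale using a b by linarith
  next
    fix k U V x y assume "k < m" "U \<in> F k" "V \<in> F k" "U \<noteq> V" and xy: "x \<in> U" "y \<in> V"
    then obtain J K where J: "J \<subseteq> I" "finite J" "card J = Suc k" "U = C J"
      and K: "K \<subseteq> I" "finite K" "card K = Suc k" "V = C K"
      unfolding F_def by auto
    have "\<not> J \<subseteq> K" "\<not> K \<subseteq> J"
      using J K \<open>U \<noteq> V\<close> card_subset_eq by metis+
    then obtain j i where ji: "j \<in> J" "j \<notin> K" "i \<in> K" "i \<notin> J"
      by blast
    then have I: "j \<in> I" "i \<in> I"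
      using J K by auto
    have M: "x \<in> M" "y \<in> M"
      using xy J K unfolding C_def by auto
    have "\<sigma> i x + 2 * r \<le> \<sigma> j x" "\<sigma> j y + 2 * r \<le> \<sigma> i y"
      using xy J K ji I unfolding C_def by auto
    moreover have "\<sigma> j x \<le> \<sigma> j y + d x y" "\<sigma> i y \<le> \<sigma> i x + d x y"
      using depth_Lipschitz[OF M BM[OF \<open>j \<in> I\<close>]] depth_Lipschitz[OF M(2,1) BM[OF \<open>i \<in> I\<close>]] commute[of x y]
      unfolding \<sigma>_def by auto
    ultimately show "r < d x y"
      using \<open>0 < r\<close> by linarith
  next
    fix x assume "x \<in> M"
    define S where "S = {i \<in> I. 0 < \<sigma> i x}"
    define A where "A = {y \<in> M. d x y < \<rho>}"
    have "d y z \<le> 2 * \<rho>" if "y \<in> A" "z \<in> A" for y z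
      using that triangle[of y x z] commute[of x y] \<open>x \<in> M\<close> unfolding A_def by auto
    then have meets: "finite {i \<in> I. A \<inter> B i \<noteq> {}}" "card {i \<in> I. A \<inter> B i \<noteq> {}} \<le> m"
      using mult[unfolded scale multiplicity_at_le_iff, rule_format, of A] unfolding A_def by auto
    have "S \<subseteq> {i \<in> I. A \<inter> B i \<noteq> {}}"
    proof
      fix i assume "i \<in> S"
      then obtain y where "i \<in> I" "y \<in> B i" "d x y < \<rho>"
        unfolding S_def \<sigma>_def using depth_posD by blast
      then show "i \<in> {i \<in> I. A \<inter> B i \<noteq> {}}"
        using BM unfolding A_def by blast
    qed
    then have S: "finite S" "card S \<le> m"
      using meets finite_subset card_mono order_trans by meson+
    obtain l where "l \<le> m" and gap: "\<And>i. i \<in> S \<Longrightarrow> \<sigma> i x \<le> real l * (2*r) \<or> real (Suc l) * (2*r) < \<sigma> i x"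
      using gap_exists[OF S, of "2*r" "\<lambda>i. \<sigma> i x"] \<open>0 < r\<close> by auto
    define J where "J = {i \<in> I. real (Suc l) * (2*r) \<le> \<sigma> i x}"
    have "0 < real (Suc l) * (2*r)" "0 \<le> real l * (2*r)"
      using \<open>0 < r\<close> by simp_all
    then have "J \<subseteq> S"
      unfolding J_def S_def using order_less_le_trans by blast
    then have "finite J" "card J \<le> m"
      using S finite_subset card_mono order_trans by meson+
    have low: "\<sigma> i x \<le> real l * (2*r)" if i: "i \<in> I - J" for i
    proof (cases "i \<in> S")
      case True
      then show ?thesis
        using gap[of i] i unfolding J_def by auto
    next
      case False
      then have "\<sigma> i x \<le> 0"
        using i unfolding S_def by auto
      then show ?thesis
        using \<open>0 \<le> real l * (2*r)\<close> by linarith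
    qed
    obtain i where "i \<in> I" "x \<in> B i"
      using cover \<open>x \<in> M\<close> unfolding is_covering_def by auto
    have "real (Suc l) * (2*r) \<le> \<rho>"
      unfolding \<rho>_def using \<open>l \<le> m\<close> \<open>0 < r\<close> by (simp add: mult_right_mono)
    also have "\<rho> \<le> \<sigma> i x"
      using depth_ge[OF \<open>x \<in> B i\<close>, of \<rho> x] mdist_zero[OF \<open>x \<in> M\<close>] unfolding \<sigma>_def by simp
    finally have "i \<in> J"
      unfolding J_def using \<open>i \<in> I\<close> by simp
    then obtain k where k: "card J = Suc k"
      using \<open>finite J\<close> by (metis card_0_eq empty_iff not0_implies_Suc)
    have "\<sigma> i x + 2 * r \<le> \<sigma> j x" if "j \<in> J" "i \<in> I - J" for i j
      using low[OF that(2)] that(1) unfolding J_def by (auto simp: algebra_simps)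
    then have "x \<in> C J"
      using \<open>x \<in> M\<close> \<open>J \<subseteq> S\<close> unfolding C_def S_def by auto
    moreover have "C J \<in> F k"
      unfolding F_def using k \<open>finite J\<close> by (auto simp: J_def)
    moreover have "k < m"
      using k \<open>card J \<le> m\<close> by simp
    ultimately show "\<exists>k<m. \<exists>U\<in>F k. x \<in> U"
      by blast
  qed
  then show ?thesis
    by (intro exI)
qed

text \<open>
  This is the form of the Nagata dimension that behaves well under unions.
\<close>

lemma (in Metric_space) nagata_dim_le_iff_coloured:
  "nagata_dim_le M d n \<longleftrightarrow> -1 \<le> n \<and>
    (\<exists>c>0. \<forall>r>0. \<exists>F. coloured_covering M d (nat (n + 1)) r (c * r) F)"
  (is "?l \<longleftrightarrow> _ \<and> ?r")
proof
  assume ?l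
  then obtain c where "c > 0" and c: "\<And>s. s > 0 \<Longrightarrow> \<exists>(I :: 'a set set) (B :: 'a set \<Rightarrow> 'a set).
       is_covering M I B \<and> family_bounded d (c * s) I B \<and>
       ereal_of_enat (multiplicity_at M d s I B) \<le> ereal (real_of_int (n + 1))"
    unfolding nagata_dim_le_def by blast
  have n: "-1 \<le> n"
  proof -
    obtain I :: "'a set set" and B :: "'a set \<Rightarrow> 'a set"
      where "ereal_of_enat (multiplicity_at M d 1 I B) \<le> ereal (real_of_int (n + 1))"
      using c[OF zero_less_one] by blast
    moreover have "0 \<le> ereal_of_enat (multiplicity_at M d 1 I B)"
      by simp
    ultimately have "ereal 0 \<le> ereal (real_of_int (n + 1))"
      unfolding zero_ereal_def[symmetric] by (rule order_trans[rotated])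
    then show ?thesis by simp
  qed
  define m where "m = nat (n + 1)"
  have m: "ereal (real_of_int (n + 1)) = ereal_of_enat (enat m)"
    using n by (simp add: m_def)
  define c' where "c' = (c + 1) * (4 * (real m + 1))"
  have "c' > 0"
    using \<open>c > 0\<close> by (simp add: c'_def)
  have "\<exists>F. coloured_covering M d m r (c' * r) F" if "r > 0" for r
  proof -
    define s where "s = 4 * (real m + 1) * r"
    have "s > 0"
      using \<open>r > 0\<close> by (simp add: s_def)
    then obtain I :: "'a set set" and B :: "'a set \<Rightarrow> 'a set"
      where "is_covering M I B" "family_bounded d (c * s) I B" "multiplicity_at M d s I B \<le> enat m"
      using c[of s] unfolding m ereal_of_enat_le_iff by blast
    then have "\<exists>F. coloured_covering M d m r (c * s + 4 * (real m + 1) * r) F"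
      using \<open>r > 0\<close> unfolding s_def by (intro coloured_covering_of_multiplicity)
    moreover have "c * s + 4 * (real m + 1) * r = c' * r"
      by (simp add: s_def c'_def algebra_simps)
    ultimately show ?thesis by simp
  qed
  then show "-1 \<le> n \<and> ?r"
    using n \<open>c' > 0\<close> unfolding m_def by blast
next
  assume "-1 \<le> n \<and> ?r"
  then obtain c where n: "-1 \<le> n" and "c > 0"
    and c: "\<And>r. r > 0 \<Longrightarrow> \<exists>F. coloured_covering M d (nat (n + 1)) r (c * r) F"
    by blast
  define m where "m = nat (n + 1)"
  have m: "ereal (real_of_int (n + 1)) = ereal_of_enat (enat m)"
    using n by (simp add: m_def)
  have "\<exists>(I :: 'a set set) (B :: 'a set \<Rightarrow> 'a set).
       is_covering M I B \<and> family_bounded d (c * s) I B \<and>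
       ereal_of_enat (multiplicity_at M d s I B) \<le> ereal (real_of_int (n + 1))" if "s > 0" for s
  proof -
    obtain F where F: "coloured_covering M d m s (c * s) F"
      using c[OF \<open>s > 0\<close>] unfolding m_def by blast
    have "is_covering M (\<Union>k<m. F k) (\<lambda>U. U)"
      unfolding is_covering_def
    proof (intro conjI ballI subsetI)
      fix U x assume "U \<in> (\<Union>k<m. F k)" "x \<in> U"
      then show "x \<in> M"
        using coloured_coveringD(1)[OF F] by auto
    next
      fix x assume "x \<in> M"
      then show "x \<in> (\<Union>U\<in>(\<Union>k<m. F k). U)"
        using coloured_coveringD(4)[OF F] by blast
    qed
    moreover have "family_bounded d (c * s) (\<Union>k<m. F k) (\<lambda>U. U)"
      unfolding family_bounded_def ediam_le_iff
      using \<open>c > 0\<close> \<open>s > 0\<close> coloured_coveringD(2)[OF F] by auto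
    ultimately show ?thesis
      using multiplicity_coloured_covering[OF F] unfolding m ereal_of_enat_le_iff
      by (intro exI conjI)
  qed
  then show ?l
    unfolding nagata_dim_le_def using \<open>c > 0\<close> by blast
qed

section \<open>Amalgamation of coloured coverings\<close>

text \<open>
  Members of one colour on \<open>Y\<close> are apart by \<open>3r + 2R\<close>. Absorption moves a boundary by at most
  \<open>r + R\<close>, so after it has happened on both sides a separation of \<open>r\<close> is left.
\<close>

lemma (in Metric_space) coloured_covering_Un:
  assumes M: "M = Y \<union> Z" and F: "coloured_covering Y d m (3 * r + 2 * R) D F"
    and G: "coloured_covering Z d m r R G" and "0 < r" "0 \<le> R" "0 \<le> D"
  shows "\<exists>H. coloured_covering M d m r (D + 2 * (r + R)) H"
proof -
  define close where "close U V \<longleftrightarrow> (\<exists>u\<in>U. \<exists>v\<in>V. d u v \<le> r)" for U V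
  define absorb where "absorb k U = U \<union> \<Union>{V \<in> G k. close U V}" for k U
  define H where "H k = absorb k ` F k \<union> {V \<in> G k. \<forall>U\<in>F k. \<not> close U V}" for k
  have sub: "\<And>k U. k < m \<Longrightarrow> U \<in> F k \<Longrightarrow> U \<subseteq> M" "\<And>k V. k < m \<Longrightarrow> V \<in> G k \<Longrightarrow> V \<subseteq> M"
    using coloured_coveringD(1)[OF F] coloured_coveringD(1)[OF G] M by blast+
  have absorb_sub: "absorb k U \<subseteq> M" if "k < m" "U \<in> F k" for k U
    using that sub unfolding absorb_def by blast
  have near: "\<exists>u\<in>U. d x u \<le> r + R" if k: "k < m" "U \<in> F k" and x: "x \<in> absorb k U" for k U x
  proof (cases "x \<in> U")
    case True
    then have "x \<in> M"
      using sub(1)[OF k] by blast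
    then have "d x x \<le> r + R"
      using \<open>0 < r\<close> \<open>0 \<le> R\<close> by simp
    with True show ?thesis by blast
  next
    case False
    then obtain V u v where V: "V \<in> G k" "x \<in> V" "u \<in> U" "v \<in> V" "d u v \<le> r"
      using x unfolding absorb_def close_def by blast
    have "d x v \<le> R"
      using coloured_coveringD(2)[OF G] V k by blast
    moreover have "x \<in> M" "v \<in> M" "u \<in> M"
      using sub V k by blast+
    ultimately have "d x u \<le> r + R"
      using triangle[of x v u] commute[of u v] \<open>d u v \<le> r\<close> by linarith
    with \<open>u \<in> U\<close> show ?thesis by blast
  qed
  \<comment> \<open>A member that has not been absorbed by \<open>U\<close> is far from \<open>U\<close> by definition, and far from the members
    that \<open>U\<close> absorbed because these have the same colour.\<close>
  have rest: "r < d x y" if *: "k < m" "U \<in> F k" "V \<in> G k" "\<not> close U V" "x \<in> absorb k U" "y \<in> V" for k U V x y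
  proof (cases "x \<in> U")
    case True
    then show ?thesis
      using that unfolding close_def by force
  next
    case False
    then obtain W where "W \<in> G k" "x \<in> W" "close U W"
      using * unfolding absorb_def by blast
    then show ?thesis
      using * coloured_coveringD(3)[OF G, of k W V x y] by blast
  qed
  have "coloured_covering M d m r (D + 2 * (r + R)) H"
    unfolding coloured_covering_def
  proof (intro conjI allI impI ballI)
    fix k U assume k: "k < m" and U: "U \<in> H k"
    show "U \<subseteq> M"
      using U absorb_sub[OF k] sub(2)[OF k] unfolding H_def by blast
  next
    fix k U x y assume k: "k < m" and U: "U \<in> H k" and xy: "x \<in> U" "y \<in> U"
    consider (absorb) W where "W \<in> F k" "U = absorb k W" | (keep) "U \<in> G k"
      using U unfolding H_def by blast
    then show "d x y \<le> D + 2 * (r + R)"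
    proof cases
      case absorb
      obtain a b where ab: "a \<in> W" "d x a \<le> r + R" "b \<in> W" "d y b \<le> r + R"
        using near[OF k] absorb xy by meson
      have "x \<in> M" "y \<in> M" "a \<in> M" "b \<in> M"
        using absorb absorb_sub[OF k] sub(1)[OF k] xy ab by blast+
      then have "d x y \<le> d x a + d a b + d y b"
        using triangle[of x a y] triangle[of a b y] commute[of b y] by linarith
      moreover have "d a b \<le> D"
        using coloured_coveringD(2)[OF F k] absorb ab by blast
      ultimately show ?thesis
        using ab(2,4) by argo
    next
      case keep
      then have "d x y \<le> R"
        using coloured_coveringD(2)[OF G k] xy by blast
      then show ?thesis
        using \<open>0 < r\<close> \<open>0 \<le> R\<close> \<open>0 \<le> D\<close> by argo
    qed
  next
    fix k U V x y
    assume k: "k < m" and UV: "U \<in> H k" "V \<in> H k" "U \<noteq> V" and xy: "x \<in> U" "y \<in> V"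
    have sym: "d x y = d y x"
      by (rule commute)
    consider (aa) U' V' where "U' \<in> F k" "U = absorb k U'" "V' \<in> F k" "V = absorb k V'"
      | (ak) U' where "U' \<in> F k" "U = absorb k U'" "V \<in> G k" "\<not> close U' V"
      | (ka) V' where "V' \<in> F k" "V = absorb k V'" "U \<in> G k" "\<not> close V' U"
      | (kk) "U \<in> G k" "V \<in> G k"
      using UV unfolding H_def by blast
    then show "r < d x y"
    proof cases
      case aa
      then have "U' \<noteq> V'"
        using \<open>U \<noteq> V\<close> by blast
      obtain a b where ab: "a \<in> U'" "d x a \<le> r + R" "b \<in> V'" "d y b \<le> r + R"
        using near[OF k] aa xy by meson
      have "x \<in> M" "y \<in> M" "a \<in> M" "b \<in> M"
        using aa absorb_sub[OF k] sub(1)[OF k] xy ab by blast+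
      then have "d a b \<le> d x a + d x y + d y b"
        using triangle[of a x b] triangle[of x y b] commute[of a x] by linarith
      moreover have "3 * r + 2 * R < d a b"
        using coloured_coveringD(3)[OF F k] aa \<open>U' \<noteq> V'\<close> ab by blast
      ultimately show ?thesis
        using ab by linarith
    next
      case ak
      then show ?thesis using rest[OF k] xy by blast
    next
      case ka
      then show ?thesis using rest[OF k] xy sym by metis
    next
      case kk
      then show ?thesis using coloured_coveringD(3)[OF G k] UV xy by blast
    qed
  next
    fix x assume "x \<in> M"
    then consider "x \<in> Y" | "x \<in> Z"
      using M by blast
    then show "\<exists>k<m. \<exists>U\<in>H k. x \<in> U"
    proof cases
      case 1
      then obtain k U where "k < m" "U \<in> F k" "x \<in> U"
        using coloured_coveringD(4)[OF F] by blast
      then show ?thesis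
        unfolding H_def absorb_def by blast
    next
      case 2
      then obtain k V where k: "k < m" "V \<in> G k" "x \<in> V"
        using coloured_coveringD(4)[OF G] by blast
      show ?thesis
      proof (cases "\<exists>U\<in>F k. close U V")
        case True
        then obtain U where "U \<in> F k" "close U V"
          by blast
        then have "absorb k U \<in> H k" "x \<in> absorb k U"
          using k unfolding H_def absorb_def by blast+
        then show ?thesis using k by blast
      next
        case False
        then show ?thesis using k unfolding H_def by blast
      qed
    qed
  qed
  then show ?thesis
    by (intro exI)
qed

section \<open>The dimension of a union\<close>

lemma (in Metric_space) nagata_dim_le_subset:
  assumes "Y \<subseteq> M" "nagata_dim_le M d n"
  shows "nagata_dim_le Y d n"
proof -
  interpret Y: Metric_space Y d
    by (rule subspace[OF \<open>Y \<subseteq> M\<close>])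
  obtain c where "-1 \<le> n" "c > 0"
    and "\<And>r. r > 0 \<Longrightarrow> \<exists>F. coloured_covering M d (nat (n + 1)) r (c * r) F"
    using assms(2) unfolding nagata_dim_le_iff_coloured by blast
  then have "\<exists>F. coloured_covering Y d (nat (n + 1)) r (c * r) F" if "r > 0" for r
    using coloured_covering_subset[of M d "nat (n + 1)" r "c * r", OF _ \<open>Y \<subseteq> M\<close>] that by blast
  then show ?thesis
    using \<open>-1 \<le> n\<close> \<open>c > 0\<close> unfolding Y.nagata_dim_le_iff_coloured by blast
qed

lemma (in Metric_space) nagata_dim_le_mono:
  assumes "nagata_dim_le M d n" "n \<le> n'"
  shows "nagata_dim_le M d n'"
proof -
  have "nat (n + 1) \<le> nat (n' + 1)"
    using \<open>n \<le> n'\<close> by simp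
  moreover obtain c where "-1 \<le> n" "c > 0"
    and "\<And>r. r > 0 \<Longrightarrow> \<exists>F. coloured_covering M d (nat (n + 1)) r (c * r) F"
    using assms(1) unfolding nagata_dim_le_iff_coloured by blast
  ultimately have "\<exists>F. coloured_covering M d (nat (n' + 1)) r (c * r) F" if "r > 0" for r
    using coloured_covering_more_colours[of M d "nat (n + 1)" r "c * r" _ "nat (n' + 1)"] that by blast
  moreover have "-1 \<le> n'"
    using \<open>-1 \<le> n\<close> \<open>n \<le> n'\<close> by simp
  ultimately show ?thesis
    using \<open>c > 0\<close> unfolding nagata_dim_le_iff_coloured by blast
qed

lemma (in Metric_space) nagata_dim_le_Un:
  assumes M: "M = Y \<union> Z" and Y: "nagata_dim_le Y d n" and Z: "nagata_dim_le Z d n"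
  shows "nagata_dim_le M d n"
proof -
  interpret Y: Metric_space Y d
    by (rule subspace) (simp add: M)
  interpret Z: Metric_space Z d
    by (rule subspace) (simp add: M)
  define m where "m = nat (n + 1)"
  obtain a where n: "-1 \<le> n" and a: "a > 0" "\<And>r. r > 0 \<Longrightarrow> \<exists>F. coloured_covering Y d m r (a * r) F"
    using Y unfolding Y.nagata_dim_le_iff_coloured m_def by blast
  obtain b where b: "b > 0" "\<And>r. r > 0 \<Longrightarrow> \<exists>F. coloured_covering Z d m r (b * r) F"
    using Z unfolding Z.nagata_dim_le_iff_coloured m_def by blast
  define c where "c = a * (3 + 2 * b) + 2 * (1 + b)"
  have "\<exists>F. coloured_covering M d m r (c * r) F" if "r > 0" for r
  proof -
    have "3 * r + 2 * (b * r) > 0"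
      using \<open>r > 0\<close> b(1) by (simp add: add_pos_pos)
    then obtain F where F: "coloured_covering Y d m (3 * r + 2 * (b * r)) (a * (3 * r + 2 * (b * r))) F"
      using a(2) by blast
    obtain G where G: "coloured_covering Z d m r (b * r) G"
      using b(2)[OF \<open>r > 0\<close>] by blast
    have "\<exists>H. coloured_covering M d m r (a * (3 * r + 2 * (b * r)) + 2 * (r + b * r)) H"
      using a(1) b(1) \<open>r > 0\<close> by (intro coloured_covering_Un[OF M F G]) auto
    moreover have "a * (3 * r + 2 * (b * r)) + 2 * (r + b * r) = c * r"
      by (simp add: c_def algebra_simps)
    ultimately show ?thesis by simp
  qed
  moreover have "c > 0"
    using a(1) b(1) by (simp add: c_def add_pos_pos)
  ultimately show ?thesis
    using n unfolding nagata_dim_le_iff_coloured m_def by blast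
qed

theorem proposition2p7:
  fixes X Y Z :: "'a set" and d :: "'a \<Rightarrow> 'a \<Rightarrow> real"
  assumes "Metric_space X d"
    and "X = Y \<union> Z"
  shows "nagata_dim X d = Sup {nagata_dim Y d, nagata_dim Z d}"
proof -
  interpret Metric_space X d by fact
  have sub: "Y \<subseteq> X" "Z \<subseteq> X"
    using assms(2) by auto
  interpret Y: Metric_space Y d
    by (rule subspace[OF sub(1)])
  interpret Z: Metric_space Z d
    by (rule subspace[OF sub(2)])
  have mono: "nagata_dim W d \<le> nagata_dim X d" if "W \<subseteq> X" for W
    unfolding nagata_dim_def using nagata_dim_le_subset[OF that] by (intro Inf_superset_mono) blast
  have "nagata_dim X d \<le> max (nagata_dim Y d) (nagata_dim Z d)"
  proof (rule ccontr)
    assume "\<not> ?thesis"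
    then have "nagata_dim Y d < nagata_dim X d" "nagata_dim Z d < nagata_dim X d"
      unfolding not_le max_less_iff_conj by simp_all
    then obtain n k where n: "nagata_dim_le Y d n" "ereal (real_of_int n) < nagata_dim X d"
      and k: "nagata_dim_le Z d k" "ereal (real_of_int k) < nagata_dim X d"
      unfolding nagata_dim_def[of Y] nagata_dim_def[of Z] Inf_less_iff by blast
    have "nagata_dim_le X d (max n k)"
      using nagata_dim_le_Un[OF assms(2)] Y.nagata_dim_le_mono[OF n(1)] Z.nagata_dim_le_mono[OF k(1)]
      by simp
    then have "nagata_dim X d \<le> ereal (real_of_int (max n k))"
      unfolding nagata_dim_def by (intro Inf_lower) blast
    then show False
      using n(2) k(2) by (auto simp: max_def split: if_splits)
  qed
  then show ?thesis
    using mono[OF sub(1)] mono[OF sub(2)] by (simp add: sup_max antisym)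
qed

end
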